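(* Let $(X,\sigma)$ be a binary subshift. Then $(X,\sigma)$ is non-tame if and only if there exists an uncountable choice domain $\mathcal T\subseteq X$.
   Context: $\mathbb N=\{1,2,\ldots\}$. A binary subshift $(X,\sigma)$ is a closed subset $X\subseteq\{0,1\}^{\mathbb N}$ (product topology) with $\sigma(X)\subseteq X$, where $\sigma$ is the left shift. Its Ellis semigroup is $E(X)=\overline{\{\sigma^n:n\in\mathbb N\}}\subseteq X^X$ (closure in the product topology, composition as operation). $(X,\sigma)$ is non-tame if $E(X)$ contains a (topological) copy of the Stone-Čech compactification $\beta\mathbb N$ of $\mathbb N$. A subset $\mathcal T\subseteq X$ is a choice domain if for all $m,n\in\mathbb N$, any $n$ distinct points $(x^1_\ell)_{\ell\in\mathbb N},\ldots,(x^n_\ell)_{\ell\in\mathbb N}\in\mathcal T$, and any $(\phi^1_k)_{k=1}^m,\ldots,(\phi^n_k)_{k=1}^m\in\{0,1\}^m$, there are times $\tau_1<\ldots<\tau_m$ in $\mathbb N$ such that $x^i_{\tau_k}=\phi^i_k$ for all $i=1,\ldots,n$ and $k=1,\ldots,m$. *)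

theory Defs
  imports "HOL-Analysis.Analysis"
begin

section \<open>Stone-Cech compactification\<close>

text \<open>
  The Stone-Cech compactification of a (Tychonoff) space \<open>X\<close>, realised in the usual way as the closure
  of the image of \<open>X\<close> in the cube \<open>[0,1]\<^bsup>C(X,[0,1])\<^esup>\<close> under evaluation.
\<close>

definition unit_maps :: "'a topology \<Rightarrow> ('a \<Rightarrow> real) set"
  where "unit_maps X = {f. continuous_map X (top_of_set {0..1}) f}"

definition unit_cube :: "'a topology \<Rightarrow> (('a \<Rightarrow> real) \<Rightarrow> real) topology"
  where "unit_cube X = product_topology (\<lambda>_. top_of_set {0..1}) (unit_maps X)"

definition cube_eval :: "'a topology \<Rightarrow> 'a \<Rightarrow> ('a \<Rightarrow> real) \<Rightarrow> real"
  where "cube_eval X x = (\<lambda>f\<in>unit_maps X. f x)"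

definition stone_cech :: "'a topology \<Rightarrow> (('a \<Rightarrow> real) \<Rightarrow> real) topology"
  where "stone_cech X =
    subtopology (unit_cube X) (unit_cube X closure_of (cube_eval X ` topspace X))"

abbreviation beta_nat :: "((nat \<Rightarrow> real) \<Rightarrow> real) topology"
  where "beta_nat \<equiv> stone_cech (discrete_topology (UNIV :: nat set))"

lemma cube_eval_in: "x \<in> topspace X \<Longrightarrow> cube_eval X x \<in> topspace (unit_cube X)"
  by (auto simp: unit_cube_def cube_eval_def unit_maps_def continuous_map_def Pi_iff)

lemma topspace_stone_cech:
  "topspace (stone_cech X) = unit_cube X closure_of (cube_eval X ` topspace X)"
  by (simp add: stone_cech_def closure_of_subset_topspace inf_absorb2)

lemma compact_space_stone_cech: "compact_space (stone_cech X)"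
proof -
  have "compact_space (unit_cube X)"
    unfolding unit_cube_def
    by (simp add: compact_space_product_topology compact_space_subtopology)
  then show ?thesis
    unfolding stone_cech_def
    by (intro compact_space_subtopology closedin_compact_space closedin_closure_of)
qed

lemma Hausdorff_space_stone_cech: "Hausdorff_space (stone_cech X)"
  unfolding stone_cech_def unit_cube_def
  by (intro Hausdorff_space_subtopology)
    (simp add: Hausdorff_space_product_topology Hausdorff_space_subtopology)

lemma dense_cube_eval:
  "stone_cech X closure_of (cube_eval X ` topspace X) = topspace (stone_cech X)"
proof -
  let ?E = "cube_eval X ` topspace X"
  have sub: "?E \<subseteq> unit_cube X closure_of ?E"
    by (intro closure_of_subset) (auto intro: cube_eval_in)
  have "stone_cech X closure_of ?E =
      unit_cube X closure_of ?E \<inter> unit_cube X closure_of (unit_cube X closure_of ?E \<inter> ?E)"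
    unfolding stone_cech_def by (rule closure_of_subtopology)
  also have "unit_cube X closure_of ?E \<inter> ?E = ?E"
    using sub by (rule Int_absorb1)
  finally show ?thesis
    by (simp only: topspace_stone_cech Int_absorb)
qed

lemma stone_cech_extension:
  assumes "continuous_map X (top_of_set {0..1}) f"
  shows "\<exists>g. continuous_map (stone_cech X) (top_of_set {0..1}) g \<and>
             (\<forall>x\<in>topspace X. g (cube_eval X x) = (f x :: real))"
proof (intro exI conjI ballI)
  have f: "f \<in> unit_maps X"
    using assms by (simp add: unit_maps_def)
  show "continuous_map (stone_cech X) (top_of_set {0..1}) (\<lambda>p. p f)"
    unfolding stone_cech_def unit_cube_def
    by (intro continuous_map_from_subtopology continuous_map_product_projection f)
  show "cube_eval X x f = f x" for x
    using f by (simp add: cube_eval_def)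
qed

lemma embedding_map_cube_eval_discrete:
  "embedding_map (discrete_topology UNIV) (stone_cech (discrete_topology UNIV)) (cube_eval (discrete_topology UNIV))"
proof -
  let ?D = "discrete_topology UNIV :: 'a topology"
  let ?S = "subtopology (stone_cech ?D) (range (cube_eval ?D))"
  define \<delta> :: "'a \<Rightarrow> 'a \<Rightarrow> real" where "\<delta> x y = (if y = x then 1 else 0)" for x y
  have \<delta>: "\<delta> x \<in> unit_maps ?D" for x
    by (auto simp: unit_maps_def \<delta>_def)
  have ev: "cube_eval ?D y (\<delta> x) = \<delta> x y" for x y
    using \<delta> by (simp add: cube_eval_def)
  have inj: "inj (cube_eval ?D)"
  proof (rule injI)
    fix x y assume "cube_eval ?D x = cube_eval ?D y"
    then have "\<delta> x x = \<delta> x y"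
      by (simp only: ev[symmetric])
    then show "x = y" by (auto simp: \<delta>_def split: if_splits)
  qed
  have sub: "range (cube_eval ?D) \<subseteq> topspace (stone_cech ?D)"
    using closure_of_subset[of "cube_eval ?D ` topspace ?D" "unit_cube ?D"] cube_eval_in[of _ ?D]
    by (simp add: topspace_stone_cech image_subset_iff)
  have single: "openin ?S {cube_eval ?D x}" for x
  proof -
    have "continuous_map (stone_cech ?D) euclideanreal (\<lambda>p. p (\<delta> x))"
      using continuous_map_product_projection[OF \<delta>, of "\<lambda>_. top_of_set {0..1::real}"]
      unfolding stone_cech_def unit_cube_def
      by (auto intro: continuous_map_from_subtopology continuous_map_into_fulltopology)
    then have "openin (stone_cech ?D) {p \<in> topspace (stone_cech ?D). p (\<delta> x) \<in> {0<..}}"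
      by (rule openin_continuous_map_preimage) (simp add: open_greaterThan)
    moreover have "{cube_eval ?D x} =
        {p \<in> topspace (stone_cech ?D). p (\<delta> x) \<in> {0<..}} \<inter> range (cube_eval ?D)"
      using sub by (auto simp: ev \<delta>_def split: if_splits)
    ultimately show ?thesis
      by (auto simp: openin_subtopology)
  qed
  have "openin ?S (cube_eval ?D ` U)" for U
  proof -
    have "openin ?S (\<Union>x\<in>U. {cube_eval ?D x})"
      using single by (intro openin_Union) blast
    then show ?thesis
      by (simp only: UNION_singleton_eq_range)
  qed
  then have "homeomorphic_map ?D ?S (cube_eval ?D)"
    using sub inj by (intro bijective_open_imp_homeomorphic_map)
      (auto simp: open_map_def Int_absorb1 inf_absorb2)
  then show ?thesis
    by (simp add: embedding_map_def)
qed


section \<open>Binary subshifts, Ellis semigroup, tameness\<close>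

text \<open>
  Points of \<open>{0,1}\<^bsup>\<nat>\<^esup>\<close> are functions \<open>nat \<Rightarrow> bool\<close>, with the product topology of the library's instance
  for function spaces. The positions \<open>1, 2, \<dots>\<close> of a sequence are renumbered as \<open>0, 1, \<dots>\<close>: the value
  \<open>x\<^sub>l\<close> is \<open>x (l - 1)\<close>. Iterates of the shift are not renumbered.
\<close>

definition shift :: "(nat \<Rightarrow> bool) \<Rightarrow> nat \<Rightarrow> bool"
  where "shift x = (\<lambda>l. x (Suc l))"

definition binary_subshift :: "(nat \<Rightarrow> bool) set \<Rightarrow> bool"
  where "binary_subshift X \<longleftrightarrow> closed X \<and> shift ` X \<subseteq> X"

text \<open>
  The space \<open>X\<^sup>X\<close> consists of the functions from \<open>X\<close> to \<open>X\<close> extended by \<open>undefined\<close> outside \<open>X\<close>.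
  Accordingly the iterates of the shift are restricted to \<open>X\<close>.
\<close>

definition self_maps :: "(nat \<Rightarrow> bool) set \<Rightarrow> ((nat \<Rightarrow> bool) \<Rightarrow> (nat \<Rightarrow> bool)) topology"
  where "self_maps X = product_topology (\<lambda>_. top_of_set X) X"

definition ellis_semigroup :: "(nat \<Rightarrow> bool) set \<Rightarrow> ((nat \<Rightarrow> bool) \<Rightarrow> (nat \<Rightarrow> bool)) set"
  where "ellis_semigroup X = self_maps X closure_of {restrict (shift ^^ n) X |n. n \<ge> 1}"

definition non_tame :: "(nat \<Rightarrow> bool) set \<Rightarrow> bool"
  where "non_tame X \<longleftrightarrow>
    (\<exists>h. embedding_map beta_nat (subtopology (self_maps X) (ellis_semigroup X)) h)"

definition choice_domain :: "(nat \<Rightarrow> bool) set \<Rightarrow> (nat \<Rightarrow> bool) set \<Rightarrow> bool"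
  where "choice_domain X T \<longleftrightarrow> T \<subseteq> X \<and>
    (\<forall>m\<ge>1. \<forall>n\<ge>1. \<forall>(x :: nat \<Rightarrow> nat \<Rightarrow> bool) (\<phi> :: nat \<Rightarrow> nat \<Rightarrow> bool).
       x ` {1..n} \<subseteq> T \<and> inj_on x {1..n} \<longrightarrow>
       (\<exists>\<tau> :: nat \<Rightarrow> nat. strict_mono_on {1..m} \<tau> \<and>
          (\<forall>i\<in>{1..n}. \<forall>k\<in>{1..m}. x i (\<tau> k) = \<phi> i k)))"

end

theory Submission
  imports Defs
begin

text \<open>
  Both conditions are equivalent to a third one: there is an infinite set \<open>M\<close> of positive times such
  that the points of \<open>X\<close> take all patterns in \<open>{0,1}\<^bsup>M\<^esup>\<close> along \<open>M\<close>. Such an \<open>M\<close> is called free for \<open>X\<close>.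

  A free set comes from the following argument (\<open>infinite_free_times_if_dense_split\<close>). Suppose that
  \<open>g\<close> is a \<open>{0,1}\<close>-valued function on a nonempty set \<open>D \<subseteq> X\<close> that takes both values densely in \<open>D\<close>, and
  that on each finite subset of \<open>D\<close> it agrees with some coordinate \<open>x \<mapsto> x t\<close>, \<open>t \<ge> 1\<close>. Then any finite set
  \<open>N\<close> that is free for \<open>D\<close> can be enlarged: by density each pattern on \<open>N\<close> is taken by a point with
  \<open>g = 0\<close> and by a point with \<open>g = 1\<close>, and a coordinate that agrees with \<open>g\<close> on these finitely many
  points is a further free time. Compactness of \<open>X\<close> passes from finite sets to their increasing union.

  From an uncountable choice domain \<open>T\<close>, let \<open>D\<close> be the set of its condensation points in \<open>T\<close>, and let
  \<open>g\<close> vanish exactly on a countable dense subset of \<open>D\<close>; the definition of a choice domain provides the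
  coordinates that agree with \<open>g\<close> on finite sets. Conversely, if \<open>M = {n\<^sub>0 < n\<^sub>1 < \<dots>}\<close> is free, an
  independent family of continuum many sets \<open>S\<^sub>A \<subseteq> \<nat>\<close> yields points \<open>y\<^sub>A \<in> X\<close> with \<open>y\<^sub>A n\<^sub>k = 1\<close> iff
  \<open>k \<in> S\<^sub>A\<close>, and these points form a choice domain.

  If \<open>M\<close> is free, the map \<open>k \<mapsto> \<sigma>\<^bsup>n\<^sub>k\<^esup>\<close> extends continuously to \<open>\<beta>\<nat> \<rightarrow> E(X)\<close>. The extension is injective:
  two distinct ultrafilters are separated by some \<open>A \<subseteq> \<nat>\<close>, and the point \<open>x \<in> X\<close> with \<open>x n\<^sub>k = 1\<close> iff
  \<open>k \<in> A\<close> separates their images.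

  Suppose finally that there is no infinite free set of positive times. For \<open>p \<in> E(X)\<close> and each \<open>l\<close>,
  the function \<open>x \<mapsto> (p x) l\<close> agrees on finite sets with coordinates, so the argument above shows that on
  each nonempty closed \<open>F \<subseteq> X\<close> it is constant on some nonempty relatively open part of \<open>F\<close>. Hence
  \<open>{x \<in> X. (p x) l = 1}\<close> is an \<open>F\<^sub>\<sigma>\<close> set. There are only continuum many sequences of \<open>F\<^sub>\<sigma>\<close> sets, so \<open>E(X)\<close>
  has at most the cardinality of the continuum and cannot contain \<open>\<beta>\<nat>\<close>, which has as many points as
  there are sets of subsets of \<open>\<nat>\<close>.
\<close>

section \<open>Free sets of times\<close>

text \<open>
  A set \<open>M\<close> of times is free for a set \<open>D\<close> of sequences if every \<open>{0,1}\<close>-pattern on \<open>M\<close> is the restriction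
  of some member of \<open>D\<close>. The pattern is given as a function on all of \<open>\<nat>\<close>, whose values outside \<open>M\<close> are
  irrelevant.
\<close>

definition free_times :: "(nat \<Rightarrow> bool) set \<Rightarrow> nat set \<Rightarrow> bool"
  where "free_times D M \<longleftrightarrow> (\<forall>\<phi>. \<exists>x\<in>D. \<forall>t\<in>M. x t = \<phi> t)"

lemma free_times_mono:
  assumes "free_times D M" "D \<subseteq> X" "N \<subseteq> M"
  shows "free_times X N"
  unfolding free_times_def
proof
  fix \<phi> :: "nat \<Rightarrow> bool"
  obtain x where "x \<in> D" "\<forall>t\<in>M. x t = \<phi> t"
    using assms(1) unfolding free_times_def by blast
  then have "x \<in> X" "\<forall>t\<in>N. x t = \<phi> t"
    using assms by auto
  then show "\<exists>x\<in>X. \<forall>t\<in>N. x t = \<phi> t" by blast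
qed

lemma clopen_coordinate:
  "open {x :: nat \<Rightarrow> bool. x i = b}" "closed {x :: nat \<Rightarrow> bool. x i = b}"
proof -
  have *: "open {x :: nat \<Rightarrow> bool. x i = b}" for b
    using product_topology_basis'[of "{i}" "\<lambda>_. {b}" "\<lambda>j. j"] by (simp add: open_discrete)
  then show "open {x :: nat \<Rightarrow> bool. x i = b}" .
  have "- {x :: nat \<Rightarrow> bool. x i = b} = {x. x i = (\<not> b)}"
    by auto
  then show "closed {x :: nat \<Rightarrow> bool. x i = b}"
    using * by (simp add: closed_def)
qed

lemma compact_space_bool_sequences: "compact_space (euclidean :: (nat \<Rightarrow> bool) topology)"
proof -
  have "compact_space (euclidean :: bool topology)"
    by (simp add: compact_space_def finite_imp_compact)
  then show ?thesis
    by (simp add: euclidean_product_topology[symmetric] compact_space_product_topology)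
qed

lemma Hausdorff_space_bool_sequences: "Hausdorff_space (euclidean :: (nat \<Rightarrow> bool) topology)"
proof -
  have "\<exists>U V. open U \<and> open V \<and> x \<in> U \<and> y \<in> V \<and> U \<inter> V = {}" if "x \<noteq> y" for x y :: "nat \<Rightarrow> bool"
  proof -
    obtain l where "x l \<noteq> y l"
      using \<open>x \<noteq> y\<close> by blast
    then show ?thesis
      using clopen_coordinate(1)[of l "x l"] clopen_coordinate(1)[of l "y l"]
      by (intro exI[of _ "{z. z l = x l}"] exI[of _ "{z. z l = y l}"]) auto
  qed
  then show ?thesis
    by (simp add: Hausdorff_space_def disjnt_def)
qed

lemma countable_clopen_basis:
  obtains B :: "(nat \<Rightarrow> bool) set set"
  where "countable B" "topological_basis B" "\<forall>b\<in>B. closed b"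
proof
  define cyl :: "bool list \<Rightarrow> (nat \<Rightarrow> bool) set"
    where "cyl s = (\<Inter>i<length s. {x. x i = s ! i})" for s
  show "countable (range cyl)"
    by simp
  show "topological_basis (range cyl)"
  proof (rule topological_basisI)
    show "open b" if "b \<in> range cyl" for b
      using that unfolding cyl_def
      by (elim rangeE, hypsubst) (intro open_INT finite_lessThan ballI clopen_coordinate)
    fix U :: "(nat \<Rightarrow> bool) set" and x
    assume "open U" "x \<in> U"
    then have "openin (product_topology (\<lambda>_. euclidean) UNIV) U"
      by (simp add: euclidean_product_topology)
    then obtain V where V: "finite {i. V i \<noteq> UNIV}" "x \<in> Pi\<^sub>E UNIV V" "Pi\<^sub>E UNIV V \<subseteq> U"
      using \<open>x \<in> U\<close> unfolding openin_product_topology_alt by auto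
    then obtain k where k: "\<And>i. V i \<noteq> UNIV \<Longrightarrow> i < k"
      using finite_nat_set_iff_bounded by auto
    have "cyl (map x [0..<k]) \<subseteq> Pi\<^sub>E UNIV V"
    proof
      fix y assume y: "y \<in> cyl (map x [0..<k])"
      have "y i \<in> V i" for i
      proof (cases "V i = UNIV")
        case False
        then have "y i = x i"
          using y k by (auto simp: cyl_def)
        then show ?thesis using V by (auto simp: PiE_iff)
      qed simp
      then show "y \<in> Pi\<^sub>E UNIV V" by auto
    qed
    moreover have "x \<in> cyl (map x [0..<k])"
      by (simp add: cyl_def)
    ultimately show "\<exists>b\<in>range cyl. x \<in> b \<and> b \<subseteq> U"
      using V(3) by (meson order_trans rangeI)
  qed
  show "\<forall>b\<in>range cyl. closed b"
    unfolding cyl_def by (intro ballI, elim rangeE, hypsubst) (intro closed_INT ballI clopen_coordinate)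
qed

text \<open>
  In a compact space, a family of continuous \<open>{0,1}\<close>-valued functions can be given prescribed values at a
  single point as soon as this is possible for each finite subfamily.
\<close>

lemma compact_space_prescribe_values:
  assumes "compact_space Y"
    and clopen: "\<And>i b. i \<in> I \<Longrightarrow> closedin Y {y \<in> topspace Y. P i y = (b::bool)}"
    and fin: "\<And>J. finite J \<Longrightarrow> J \<subseteq> I \<Longrightarrow> \<exists>y\<in>topspace Y. \<forall>i\<in>J. P i y = \<phi> i"
  shows "\<exists>y\<in>topspace Y. \<forall>i\<in>I. P i y = \<phi> i"
proof -
  define C where "C i = {y \<in> topspace Y. P i y = \<phi> i}" for i
  have "\<Inter> (insert (topspace Y) (C ` I)) \<noteq> {}"
  proof (rule \<open>compact_space Y\<close>[unfolded compact_space_fip, rule_format], intro conjI ballI allI impI)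
    show "closedin Y K" if "K \<in> insert (topspace Y) (C ` I)" for K
      using that clopen by (auto simp: C_def)
    fix \<F> assume \<F>: "finite \<F> \<and> \<F> \<subseteq> insert (topspace Y) (C ` I)"
    then have "finite (\<F> - {topspace Y})" "\<F> - {topspace Y} \<subseteq> C ` I"
      by auto
    then obtain J where J: "finite J" "J \<subseteq> I" "\<F> - {topspace Y} = C ` J"
      using finite_subset_image[of "\<F> - {topspace Y}" C I] by blast
    then obtain y where y: "y \<in> topspace Y" "\<forall>i\<in>J. P i y = \<phi> i"
      using fin[of J] by blast
    have "y \<in> K" if "K \<in> \<F>" for K
    proof (cases "K = topspace Y")
      case False
      then have "K \<in> C ` J"
        using that J(3) by blast
      then show ?thesis
        using y by (auto simp: C_def)
    qed (use y in simp)
    then show "\<Inter> \<F> \<noteq> {}" by blast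
  qed
  then obtain y where "y \<in> topspace Y" "\<And>i. i \<in> I \<Longrightarrow> y \<in> C i"
    by blast
  then show ?thesis by (auto simp: C_def)
qed

lemma free_times_compactness:
  assumes "closed X" and fin: "\<And>N. finite N \<Longrightarrow> N \<subseteq> M \<Longrightarrow> free_times X N"
  shows "free_times X M"
  unfolding free_times_def
proof
  fix \<phi> :: "nat \<Rightarrow> bool"
  have "compact_space (top_of_set X)"
    using closedin_compact_space[OF compact_space_bool_sequences, of X] \<open>closed X\<close>
    by (intro compact_space_subtopology) (simp add: closed_closedin[symmetric])
  moreover have "closedin (top_of_set X) {x \<in> topspace (top_of_set X). x t = b}" for t b
    using clopen_coordinate(2)[of t b] by (auto simp: closedin_closed Int_def)
  moreover have "\<exists>x\<in>topspace (top_of_set X). \<forall>t\<in>J. x t = \<phi> t" if "finite J" "J \<subseteq> M" for J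
    using fin[OF that] by (simp add: free_times_def)
  ultimately have "\<exists>x\<in>topspace (top_of_set X). \<forall>t\<in>M. x t = \<phi> t"
    by (rule compact_space_prescribe_values[of "top_of_set X" M "\<lambda>t x. x t" \<phi>])
  then show "\<exists>x\<in>X. \<forall>t\<in>M. x t = \<phi> t" by simp
qed

text \<open>
  The common source of free times. The assumption on \<open>U\<close> says that both values of \<open>g\<close> occur in
  every nonempty relatively open part of \<open>D\<close>; the last one that \<open>g\<close> is, on \<open>D\<close>, a pointwise limit of
  coordinates at positive times.
\<close>

lemma infinite_free_times_if_dense_split:
  fixes g :: "(nat \<Rightarrow> bool) \<Rightarrow> bool"
  assumes X: "closed X" "D \<subseteq> X" "D \<noteq> {}"
    and dense: "\<And>U b. open U \<Longrightarrow> U \<inter> D \<noteq> {} \<Longrightarrow> \<exists>x\<in>U \<inter> D. g x = b"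
    and approx: "\<And>J. finite J \<Longrightarrow> J \<subseteq> D \<Longrightarrow> \<exists>t\<ge>1. \<forall>x\<in>J. x t = g x"
  shows "\<exists>M. infinite M \<and> M \<subseteq> {1..} \<and> free_times X M"
proof -
  have step: "\<exists>t\<ge>1. t \<notin> N \<and> free_times D (insert t N)" if N: "finite N" "free_times D N" for N
  proof -
    have "\<exists>x\<in>D. (\<forall>t\<in>N. x t = (t \<in> S)) \<and> g x = b" for S b
    proof -
      define U where "U = (\<Inter>t\<in>N. {x::nat \<Rightarrow> bool. x t = (t \<in> S)})"
      have "open U"
        unfolding U_def
        by (intro open_INT N(1) ballI clopen_coordinate(1))
      obtain x where "x \<in> D" "\<forall>t\<in>N. x t = (t \<in> S)"
        using N(2)[unfolded free_times_def, rule_format, of "\<lambda>t. t \<in> S"] by blast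
      then have "U \<inter> D \<noteq> {}"
        by (auto simp: U_def)
      then obtain x' where "x' \<in> U \<inter> D" "g x' = b"
        using dense[OF \<open>open U\<close>] by blast
      then show ?thesis
        by (auto simp: U_def)
    qed
    then obtain x where x: "\<And>S b. x S b \<in> D" "\<And>S b t. t \<in> N \<Longrightarrow> x S b t = (t \<in> S)" "\<And>S b. g (x S b) = b"
      by metis
    \<comment> \<open>A subset \<open>S\<close> of \<open>N\<close> encodes a pattern on \<open>N\<close>; the new time \<open>t\<close> has to satisfy \<open>x S b t = b\<close>.\<close>
    define J where "J = (\<lambda>(S, b). x S b) ` (Pow N \<times> UNIV)"
    have "finite J" "J \<subseteq> D"
      using N x by (auto simp: J_def)
    then obtain t where t: "t \<ge> 1" "\<forall>y\<in>J. y t = g y"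
      using approx by blast
    have xt: "x S b t = b" if "S \<subseteq> N" for S b
    proof -
      have "x S b \<in> J" using that by (force simp: J_def)
      then show ?thesis using t(2) x(3) by metis
    qed
    have "t \<notin> N"
      using xt[of "{}"] x(2)[of t "{}" True] by auto
    moreover have "free_times D (insert t N)"
      unfolding free_times_def
    proof
      fix \<phi> :: "nat \<Rightarrow> bool"
      let ?x = "x {u \<in> N. \<phi> u} (\<phi> t)"
      have "?x t = \<phi> t"
        by (rule xt) simp
      moreover have "?x u = \<phi> u" if "u \<in> N" for u
        using x(2)[OF that] that by simp
      ultimately show "\<exists>x\<in>D. \<forall>u\<in>insert t N. x u = \<phi> u"
        by (intro bexI[of _ ?x] ballI x(1)) blast
    qed
    ultimately show ?thesis using t by blast
  qed
  have "\<exists>N. \<forall>k. (finite (N k) \<and> card (N k) = k \<and> N k \<subseteq> {1..} \<and> free_times D (N k)) \<and> N k \<subseteq> N (Suc k)"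
  proof (rule dependent_nat_choice)
    show "\<exists>N. finite N \<and> card N = 0 \<and> N \<subseteq> {1..} \<and> free_times D N"
      using X by (intro exI[of _ "{}"]) (auto simp: free_times_def)
    fix N :: "nat set" and k
    assume N: "finite N \<and> card N = k \<and> N \<subseteq> {1..} \<and> free_times D N"
    then obtain t where "t \<ge> 1" "t \<notin> N" "free_times D (insert t N)"
      using step by blast
    then show "\<exists>N'. (finite N' \<and> card N' = Suc k \<and> N' \<subseteq> {1..} \<and> free_times D N') \<and> N \<subseteq> N'"
      using N by (intro exI[of _ "insert t N"]) auto
  qed
  then obtain N where N: "\<And>k. finite (N k)" "\<And>k. card (N k) = k" "\<And>k. N k \<subseteq> {1..}"
      "\<And>k. free_times D (N k)" "\<And>k. N k \<subseteq> N (Suc k)"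
    by blast
  define M where "M = (\<Union>k. N k)"
  have "infinite M"
  proof
    assume "finite M"
    then have "card (N (Suc (card M))) \<le> card M"
      by (intro card_mono) (auto simp: M_def)
    then show False using N(2) by simp
  qed
  moreover have "M \<subseteq> {1..}"
    using N(3) by (auto simp: M_def)
  moreover have "free_times X M"
  proof (rule free_times_compactness[OF X(1)])
    fix F assume "finite F" "F \<subseteq> M"
    then have "\<exists>k. F \<subseteq> N k"
    proof (induction F)
      case (insert t F)
      then obtain k l where "F \<subseteq> N k" "t \<in> N l"
        by (auto simp: M_def)
      moreover have "N k \<subseteq> N (max k l)" "N l \<subseteq> N (max k l)"
        using lift_Suc_mono_le[of N] N(5) by auto
      ultimately show ?case by blast
    qed simp
    then obtain k where "F \<subseteq> N k" by blast
    then show "free_times X F"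
      using free_times_mono[OF N(4) X(2)] by blast
  qed
  ultimately show ?thesis by blast
qed

section \<open>Independent families and choice domains\<close>

text \<open>
  The family of Fichtenholz, Kantorovich and Hausdorff. The underlying countable set consists of triples
  \<open>(i, F, G)\<close> of a number, a finite list \<open>F\<close> of numbers and a finite list \<open>G\<close> of such lists; a triple lies
  in \<open>S A\<close> if the members of \<open>F\<close> that belong to \<open>A\<close>, listed in order, form an entry of \<open>G\<close>. The number
  \<open>i\<close> only serves to make each Boolean combination infinite.
\<close>

lemma independent_family_on_nat:
  "\<exists>S :: nat set \<Rightarrow> nat set. \<forall>\<A> \<phi>. finite \<A> \<longrightarrow> infinite {k. \<forall>A\<in>\<A>. (k \<in> S A) = \<phi> A}"
proof (intro exI allI impI)
  define S :: "nat set \<Rightarrow> nat set"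
    where "S A = {k. case from_nat k of (i::nat, F, G) \<Rightarrow> filter (\<lambda>a. a \<in> A) F \<in> set G}" for A
  fix \<A> :: "nat set set" and \<phi> assume "finite \<A>"
  \<comment> \<open>Choose \<open>F\<close> so that the finitely many sets in \<open>\<A>\<close> have different traces on it.\<close>
  have "\<exists>F. inj_on (\<lambda>A. filter (\<lambda>a. a \<in> A) F) \<A>"
  proof -
    define d where "d A B = (SOME a. (a \<in> A) \<noteq> (a \<in> B))" for A B :: "nat set"
    have d: "(d A B \<in> A) \<noteq> (d A B \<in> B)" if "A \<noteq> B" for A B
      using that unfolding d_def by (intro someI_ex[of "\<lambda>a. (a \<in> A) \<noteq> (a \<in> B)"]) blast
    have "finite ((\<lambda>(A, B). d A B) ` (\<A> \<times> \<A>))"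
      using \<open>finite \<A>\<close> by simp
    then obtain F where F: "set F = (\<lambda>(A, B). d A B) ` (\<A> \<times> \<A>)"
      using finite_list by blast
    have "inj_on (\<lambda>A. filter (\<lambda>a. a \<in> A) F) \<A>"
    proof (rule inj_onI, rule ccontr)
      fix A B assume AB: "A \<in> \<A>" "B \<in> \<A>" "filter (\<lambda>a. a \<in> A) F = filter (\<lambda>a. a \<in> B) F" "A \<noteq> B"
      have "set (filter (\<lambda>a. a \<in> A) F) = set (filter (\<lambda>a. a \<in> B) F)"
        using AB by simp
      moreover have "d A B \<in> set F"
        using F AB by force
      ultimately show False
        using d[OF \<open>A \<noteq> B\<close>] by auto
    qed
    then show ?thesis by blast
  qed
  then obtain F where F: "inj_on (\<lambda>A. filter (\<lambda>a. a \<in> A) F) \<A>" by blast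
  have "finite ((\<lambda>A. filter (\<lambda>a. a \<in> A) F) ` {A\<in>\<A>. \<phi> A})"
    using \<open>finite \<A>\<close> by simp
  then obtain G where G: "set G = (\<lambda>A. filter (\<lambda>a. a \<in> A) F) ` {A\<in>\<A>. \<phi> A}"
    using finite_list by blast
  have mem: "(to_nat (i::nat, F, G) \<in> S A) = \<phi> A" if "A \<in> \<A>" for i A
    using that F by (auto simp: S_def G inj_on_def)
  have "range (\<lambda>i::nat. to_nat (i, F, G)) \<subseteq> {k. \<forall>A\<in>\<A>. (k \<in> S A) = \<phi> A}"
    using mem by auto
  moreover have "infinite (range (\<lambda>i::nat. to_nat (i, F, G)))"
    by (intro range_inj_infinite injI) simp
  ultimately show "infinite {k. \<forall>A\<in>\<A>. (k \<in> S A) = \<phi> A}"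
    using infinite_super by blast
qed

lemma strict_mono_selection:
  fixes W :: "nat \<Rightarrow> nat set"
  assumes "\<And>k. infinite (W k)"
  obtains \<tau> where "strict_mono \<tau>" "\<And>k. \<tau> k \<in> W k"
proof -
  have "\<exists>\<tau>. \<forall>k. \<tau> k \<in> W k \<and> \<tau> k < \<tau> (Suc k)"
  proof (rule dependent_nat_choice)
    show "\<exists>t. t \<in> W 0"
      using assms[of 0] by (metis finite.emptyI ex_in_conv)
    show "\<exists>u. u \<in> W (Suc k) \<and> t < u" for t k
      using assms[of "Suc k"] by (metis infinite_nat_iff_unbounded)
  qed
  then show ?thesis
    using that by (auto simp: strict_mono_Suc_iff)
qed

lemma uncountable_choice_domain_if_free_times:
  assumes M: "infinite M" "free_times X M"
  shows "\<exists>T. choice_domain X T \<and> uncountable T"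
proof -
  obtain S :: "nat set \<Rightarrow> nat set"
    where S: "\<forall>\<A> \<phi>. finite \<A> \<longrightarrow> infinite {k. \<forall>A\<in>\<A>. (k \<in> S A) = \<phi> A}"
    using independent_family_on_nat ..
  let ?n = "enumerate M"
  have n: "inj ?n" "range ?n = M"
    using M by (auto simp: range_enumerate strict_mono_enumerate strict_mono_imp_inj_on)
  have "\<exists>x\<in>X. \<forall>k. x (?n k) = (k \<in> S A)" for A
    using M(2)[unfolded free_times_def, rule_format, of "\<lambda>t. inv ?n t \<in> S A"] n
    by (metis inv_f_f rangeI)
  then obtain y where y: "\<And>A. y A \<in> X" "\<And>A k. y A (?n k) = (k \<in> S A)"
    by metis
  have "inj y"
  proof (rule injI, rule ccontr)
    fix A B assume "y A = y B" "A \<noteq> B"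
    have "infinite {k. \<forall>C\<in>{A, B}. (k \<in> S C) = (C = A)}"
      by (rule S[rule_format]) simp
    from infinite_imp_nonempty[OF this] obtain k where "\<forall>C\<in>{A, B}. (k \<in> S C) = (C = A)"
      by blast
    then have "k \<in> S A" "k \<notin> S B"
      using \<open>A \<noteq> B\<close> by auto
    then show False
      using y(2)[of A k] y(2)[of B k] \<open>y A = y B\<close> by simp
  qed
  have "uncountable (UNIV :: nat set set)"
  proof
    assume "countable (UNIV :: nat set set)"
    then have "range (from_nat_into (UNIV :: nat set set)) = Pow UNIV"
      by (simp add: range_from_nat_into)
    then show False
      using Cantors_theorem by blast
  qed
  then have "uncountable (range y)"
    using \<open>inj y\<close> by (simp add: countable_image_inj_eq)
  moreover have "choice_domain X (range y)"
    unfolding choice_domain_def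
  proof (intro conjI allI impI)
    show "range y \<subseteq> X" using y by auto
    fix m n :: nat and x \<phi> :: "nat \<Rightarrow> nat \<Rightarrow> bool"
    assume x: "x ` {1..n} \<subseteq> range y \<and> inj_on x {1..n}"
    define A where "A i = inv y (x i)" for i
    have A: "y (A i) = x i" if "i \<in> {1..n}" for i
      using x that by (auto simp: A_def intro!: f_inv_into_f)
    have "inj_on A {1..n}"
      using x A unfolding inj_on_def by metis
    define W where "W k = ?n ` {j. \<forall>B\<in>A ` {1..n}. (j \<in> S B) = \<phi> (inv_into {1..n} A B) k}" for k
    have "infinite (W k)" for k
    proof -
      have "infinite {j. \<forall>B\<in>A ` {1..n}. (j \<in> S B) = \<phi> (inv_into {1..n} A B) k}"
        by (rule S[rule_format]) simp
      then show ?thesis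
        unfolding W_def by (simp only: finite_image_iff[OF inj_on_subset[OF n(1) subset_UNIV]] not_False_eq_True)
    qed
    then obtain \<tau> where \<tau>: "strict_mono \<tau>" "\<And>k. \<tau> k \<in> W k"
      using strict_mono_selection by blast
    have "x i (\<tau> k) = \<phi> i k" if i: "i \<in> {1..n}" for i k
    proof -
      obtain j where j: "\<tau> k = ?n j" "\<forall>B\<in>A ` {1..n}. (j \<in> S B) = \<phi> (inv_into {1..n} A B) k"
        using \<tau>(2)[of k] by (auto simp: W_def)
      have "x i (\<tau> k) = (j \<in> S (A i))"
        using A[OF i] y(2)[of "A i" j] j(1) by simp
      then show ?thesis
        using j(2) i \<open>inj_on A {1..n}\<close> by simp
    qed
    then show "\<exists>\<tau>. strict_mono_on {1..m} \<tau> \<and> (\<forall>i\<in>{1..n}. \<forall>k\<in>{1..m}. x i (\<tau> k) = \<phi> i k)"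
      using \<tau>(1) by (intro exI[of _ \<tau>]) (auto simp: strict_mono_on_def strict_mono_def)
  qed
  ultimately show ?thesis by blast
qed

lemma choice_domain_prescribe_values:
  assumes "choice_domain X T" "finite J" "J \<subseteq> T"
  shows "\<exists>t\<ge>1. \<forall>x\<in>J. x t = g x"
proof (cases "J = {}")
  case False
  define n where "n = card J"
  have "n \<ge> 1"
    using assms(2) False by (simp add: n_def Suc_le_eq card_gt_0_iff)
  obtain x where "bij_betw x {1..n} J"
    using ex_bij_betw_nat_finite_1[OF assms(2)] by (auto simp: n_def)
  then have x: "inj_on x {1..n}" "x ` {1..n} = J"
    by (auto simp: bij_betw_def)
  have "\<exists>\<tau>::nat \<Rightarrow> nat. strict_mono_on {1..2} \<tau> \<and> (\<forall>i\<in>{1..n}. \<forall>k\<in>{1..2}. x i (\<tau> k) = g (x i))"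
    using assms(1)[unfolded choice_domain_def, THEN conjunct2, rule_format, of 2 n x "\<lambda>i k. g (x i)"]
      \<open>n \<ge> 1\<close> x assms(3) by simp
  then obtain \<tau> :: "nat \<Rightarrow> nat" where \<tau>: "strict_mono_on {1..2} \<tau>"
      "\<forall>i\<in>{1..n}. \<forall>k\<in>{1..2}. x i (\<tau> k) = g (x i)"
    by blast
  \<comment> \<open>The second of two times is positive, as needed because the Ellis semigroup starts at \<open>\<sigma>\<^sup>1\<close>.\<close>
  have "\<tau> 1 < \<tau> 2"
    using \<tau>(1) by (rule strict_mono_onD) auto
  moreover have "\<forall>y\<in>J. y (\<tau> 2) = g y"
    using \<tau>(2) x(2) by auto
  ultimately show ?thesis
    by (intro exI[of _ "\<tau> 2"]) auto
qed auto

lemma free_times_if_uncountable_choice_domain: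
  assumes "closed X" "choice_domain X T" "uncountable T"
  shows "\<exists>M. infinite M \<and> M \<subseteq> {1..} \<and> free_times X M"
proof -
  obtain B :: "(nat \<Rightarrow> bool) set set" where B: "countable B" "topological_basis B"
    by (rule countable_clopen_basis)
  \<comment> \<open>The condensation points of \<open>T\<close> in \<open>T\<close>; only countably many points of \<open>T\<close> are lost.\<close>
  define D where "D = {x \<in> T. \<forall>b\<in>B. x \<in> b \<longrightarrow> uncountable (b \<inter> T)}"
  have "T - D \<subseteq> (\<Union>b\<in>{b \<in> B. countable (b \<inter> T)}. b \<inter> T)"
    by (auto simp: D_def)
  moreover have "countable (\<Union>b\<in>{b \<in> B. countable (b \<inter> T)}. b \<inter> T)"
    using B(1) by (intro countable_UN) auto
  ultimately have "countable (T - D)"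
    by (rule countable_subset)
  have unc: "uncountable (b \<inter> D)" if "b \<in> B" "b \<inter> D \<noteq> {}" for b
  proof
    assume "countable (b \<inter> D)"
    then have "countable ((b \<inter> D) \<union> (T - D))"
      using \<open>countable (T - D)\<close> by simp
    then have "countable (b \<inter> T)"
      by (rule countable_subset[rotated]) auto
    then show False
      using that by (auto simp: D_def)
  qed
  \<comment> \<open>The countable set \<open>e ` B\<close> contains a dense subset of \<open>D\<close> and misses another one.\<close>
  define e where "e b = (SOME x. x \<in> b \<inter> D)" for b
  have e: "e b \<in> b \<inter> D" if "b \<inter> D \<noteq> {}" for b
    using some_in_eq[of "b \<inter> D"] that unfolding e_def by simp
  show ?thesis
  proof (rule infinite_free_times_if_dense_split[of X D "\<lambda>x. x \<notin> e ` B"])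
    show "closed X" by fact
    show "D \<subseteq> X"
      using assms(2) by (auto simp: D_def choice_domain_def)
    show "D \<noteq> {}"
      using \<open>countable (T - D)\<close> assms(3) by auto
    show "\<exists>t\<ge>1. \<forall>x\<in>J. x t = (x \<notin> e ` B)" if "finite J" "J \<subseteq> D" for J
      using that by (intro choice_domain_prescribe_values[OF assms(2)]) (auto simp: D_def)
    fix U :: "(nat \<Rightarrow> bool) set" and c
    assume U: "open U" "U \<inter> D \<noteq> {}"
    then obtain x where "x \<in> U" "x \<in> D" by blast
    then obtain b where b: "b \<in> B" "x \<in> b" "b \<subseteq> U"
      using topological_basisE[OF B(2) U(1)] by blast
    then have ne: "b \<inter> D \<noteq> {}" using \<open>x \<in> D\<close> by blast
    show "\<exists>x\<in>U \<inter> D. (x \<notin> e ` B) = c"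
    proof (cases c)
      case True
      have "\<not> b \<inter> D \<subseteq> e ` B"
        using unc[OF b(1) ne] countable_subset[OF _ countable_image[OF B(1)]] by metis
      then obtain y where "y \<in> b \<inter> D" "y \<notin> e ` B" by blast
      then show ?thesis
        using b(3) True by (intro bexI[of _ y]) auto
    next
      case False
      then show ?thesis
        using e[OF ne] b(1,3) by (intro bexI[of _ "e b"]) auto
    qed
  qed
qed

section \<open>The size of the Ellis semigroup\<close>

text \<open>
  A \<open>{0,1}\<close>-valued function whose restriction to each nonempty closed set is constant on some nonempty
  relatively open part is the indicator of an \<open>F\<^sub>\<sigma>\<close> set, provided that these parts are cut out by members of
  a countable family \<open>B\<close> of clopen sets. Instead of a transfinite derivation, the proof takes the union \<open>V\<close>
  of all members of \<open>B\<close> on which the claim holds and applies the hypothesis to \<open>X - V\<close>.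
\<close>

lemma fsigma_if_locally_constant_on_closed:
  fixes X :: "'a::topological_space set" and f :: "'a \<Rightarrow> bool"
  assumes B: "countable B" "\<And>b. b \<in> B \<Longrightarrow> open b" "\<And>b. b \<in> B \<Longrightarrow> closed b" and "closed X"
    and const: "\<And>F. closed F \<Longrightarrow> F \<subseteq> X \<Longrightarrow> F \<noteq> {} \<Longrightarrow>
      \<exists>b\<in>B. b \<inter> F \<noteq> {} \<and> (\<exists>c. \<forall>x\<in>b \<inter> F. f x = c)"
  shows "fsigma_in euclidean {x \<in> X. f x}"
proof -
  define P where "P = {x \<in> X. f x}"
  define V where "V = \<Union>{b \<in> B. fsigma_in euclidean (P \<inter> b)}"
  have "P \<inter> V = \<Union>((\<inter>) P ` {b \<in> B. fsigma_in euclidean (P \<inter> b)})"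
    by (auto simp: V_def)
  moreover have "fsigma_in euclidean (\<Union>((\<inter>) P ` {b \<in> B. fsigma_in euclidean (P \<inter> b)}))"
    using B(1) by (intro fsigma_in_Union) auto
  ultimately have PV: "fsigma_in euclidean (P \<inter> V)"
    by simp
  have "open V"
    using B(2) by (auto simp: V_def)
  have "X - V = {}"
  proof (rule ccontr)
    assume "X - V \<noteq> {}"
    moreover have "closed (X - V)"
      using \<open>closed X\<close> \<open>open V\<close> by (rule closed_Diff)
    ultimately obtain b c where b: "b \<in> B" "b \<inter> (X - V) \<noteq> {}" "\<And>x. x \<in> b \<inter> (X - V) \<Longrightarrow> f x = c"
      using const[of "X - V"] by blast
    have "P \<inter> b = (P \<inter> V) \<inter> b \<union> (if c then b \<inter> (X - V) else {})"
      using b(3) by (auto simp: P_def)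
    moreover have "fsigma_in euclidean b" "fsigma_in euclidean (b \<inter> (X - V))"
      using B(3)[OF b(1)] \<open>closed (X - V)\<close>
      by (auto intro!: closed_imp_fsigma_in simp: closed_closedin[symmetric] closed_Int)
    ultimately have "fsigma_in euclidean (P \<inter> b)"
      using PV by (auto intro!: fsigma_in_Un fsigma_in_Int)
    then have "b \<subseteq> V"
      using b(1) by (auto simp: V_def)
    then show False using b(2) by blast
  qed
  then have "P \<inter> V = P"
    by (auto simp: P_def)
  then show ?thesis
    using PV by (simp add: P_def)
qed

text \<open>
  There are at most continuum many \<open>F\<^sub>\<sigma>\<close> sets: a closed set is coded by a set of indices of basic open sets
  with union its complement, and a sequence of sets of numbers by a single one.
\<close>

lemma fsigma_sets_coded_by_nat_sets:
  "\<exists>d :: nat set \<Rightarrow> (nat \<Rightarrow> bool) set. \<forall>P. fsigma_in euclidean P \<longrightarrow> P \<in> range d"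
proof -
  obtain B :: "(nat \<Rightarrow> bool) set set" where B: "countable B" "topological_basis B"
    by (rule countable_clopen_basis)
  define e where "e = from_nat_into B"
  define d where "d a = (\<Union>n. - \<Union>(e ` {k. prod_encode (n, k) \<in> a}))" for a
  have closed_coded: "\<exists>a. C = - \<Union>(e ` a)" if C: "closed C" for C
  proof -
    obtain B' where B': "B' \<subseteq> B" "\<Union>B' = - C"
      using B(2) open_Compl[OF C] unfolding topological_basis_def by blast
    have "B' \<subseteq> range e"
    proof
      fix b assume "b \<in> B'"
      then have "b \<in> B" using B' by blast
      then have "e (to_nat_on B b) = b"
        using B(1) by (simp add: e_def)
      then show "b \<in> range e" by (metis rangeI)
    qed
    then have "e ` (e -` B') = B'"
      by auto
    then have "C = - \<Union>(e ` (e -` B'))"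
      using B'(2) by simp
    then show ?thesis by blast
  qed
  have "P \<in> range d" if P: "fsigma_in euclidean P" for P
  proof -
    obtain C :: "nat \<Rightarrow> (nat \<Rightarrow> bool) set" where C: "\<And>n. closed (C n)" "\<Union>(range C) = P"
      using P unfolding fsigma_in_ascending closed_closedin[symmetric] by blast
    obtain a where a: "\<And>n::nat. C n = - \<Union>(e ` a n)"
      using closed_coded[OF C(1)] by metis
    have "d {prod_encode (n, k) |n k. k \<in> a n} = P"
      using a C(2) by (auto simp: d_def)
    then show ?thesis by blast
  qed
  then show ?thesis by blast
qed

lemma shift_funpow: "(shift ^^ n) x l = x (l + n)"
  by (induction n arbitrary: x l) (simp_all add: shift_def)

lemma topspace_self_maps: "topspace (self_maps X) = X \<rightarrow>\<^sub>E X"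
  by (simp add: self_maps_def)

text \<open>
  On finitely many points, each coordinate of an element of the Ellis semigroup is a coordinate at a positive
  time, because \<open>\<sigma>\<^sup>n x\<close> has entry \<open>x (l + n)\<close> at position \<open>l\<close>.
\<close>

lemma ellis_semigroup_approx:
  assumes p: "p \<in> ellis_semigroup X" and J: "finite J" "J \<subseteq> X"
  shows "\<exists>t\<ge>1. \<forall>x\<in>J. x t = p x l"
proof -
  define U where "U = {q \<in> topspace (self_maps X). \<forall>x\<in>J. q x \<in> {y \<in> topspace (top_of_set X). y l = p x l}}"
  have "openin (self_maps X) {q \<in> topspace (self_maps X). q x \<in> {y \<in> topspace (top_of_set X). y l = p x l}}"
    if "x \<in> J" for x
  proof (rule openin_continuous_map_preimage)
    show "continuous_map (self_maps X) (top_of_set X) (\<lambda>q. q x)"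
      unfolding self_maps_def using that J(2) by (intro continuous_map_product_projection) auto
    show "openin (top_of_set X) {y \<in> topspace (top_of_set X). y l = p x l}"
      using clopen_coordinate(1)[of l "p x l"] by (auto simp: openin_open Int_def)
  qed
  then have "openin (self_maps X) (topspace (self_maps X) \<inter> (\<Inter>x\<in>J. {q \<in> topspace (self_maps X). q x \<in> {y \<in> topspace (top_of_set X). y l = p x l}}))"
    using J(1) by (intro openin_Int_Inter) auto
  moreover have "topspace (self_maps X) \<inter> (\<Inter>x\<in>J. {q \<in> topspace (self_maps X). q x \<in> {y \<in> topspace (top_of_set X). y l = p x l}}) = U"
    by (auto simp: U_def)
  ultimately have "openin (self_maps X) U"
    by simp
  moreover have "p \<in> topspace (self_maps X)"
    using p by (simp add: ellis_semigroup_def in_closure_of)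
  then have "p \<in> U"
    using J(2) by (auto simp: U_def topspace_self_maps)
  ultimately obtain n where n: "n \<ge> 1" "restrict (shift ^^ n) X \<in> U"
    using p[unfolded ellis_semigroup_def in_closure_of, THEN conjunct2, rule_format, of U] by blast
  have "x (l + n) = p x l" if "x \<in> J" for x
  proof -
    have "restrict (shift ^^ n) X x l = p x l"
      using n(2) that by (simp add: U_def)
    then show ?thesis
      using that J(2) by (simp add: shift_funpow subsetD)
  qed
  then show ?thesis
    using n(1) by (intro exI[of _ "l + n"]) auto
qed

lemma ellis_coordinate_fsigma:
  assumes "closed X" and no_free: "\<nexists>M. infinite M \<and> M \<subseteq> {1..} \<and> free_times X M"
    and p: "p \<in> ellis_semigroup X"
  shows "fsigma_in euclidean {x \<in> X. p x l}"
proof -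
  obtain B :: "(nat \<Rightarrow> bool) set set"
    where B: "countable B" "topological_basis B" "\<forall>b\<in>B. closed b"
    by (rule countable_clopen_basis)
  show ?thesis
  proof (rule fsigma_if_locally_constant_on_closed[OF B(1) topological_basis_open[OF B(2)] bspec[OF B(3)] \<open>closed X\<close>])
    fix F assume F: "closed F" "F \<subseteq> X" "F \<noteq> {}"
    show "\<exists>b\<in>B. b \<inter> F \<noteq> {} \<and> (\<exists>c. \<forall>x\<in>b \<inter> F. p x l = c)"
    proof (rule ccontr)
      assume nc: "\<not> ?thesis"
      have "\<exists>M. infinite M \<and> M \<subseteq> {1..} \<and> free_times X M"
      proof (rule infinite_free_times_if_dense_split[OF \<open>closed X\<close> F(2,3), of "\<lambda>x. p x l"])
        show "\<exists>t\<ge>1. \<forall>x\<in>J. x t = p x l" if "finite J" "J \<subseteq> F" for J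
          using that F(2) by (intro ellis_semigroup_approx[OF p]) auto
        fix U :: "(nat \<Rightarrow> bool) set" and c
        assume U: "open U" "U \<inter> F \<noteq> {}"
        then obtain x where "x \<in> U" "x \<in> F" by blast
        then obtain b where b: "b \<in> B" "x \<in> b" "b \<subseteq> U"
          using topological_basisE[OF B(2) U(1)] by blast
        then have "\<not> (\<forall>x\<in>b \<inter> F. p x l = (\<not> c))"
          using nc \<open>x \<in> F\<close> by blast
        then show "\<exists>x\<in>U \<inter> F. p x l = c"
          using b(3) by blast
      qed
      then show False using no_free by blast
    qed
  qed
qed

lemma ellis_semigroup_coded_by_nat_sets:
  assumes "closed X" and no_free: "\<nexists>M. infinite M \<and> M \<subseteq> {1..} \<and> free_times X M"
  shows "\<exists>D :: nat set \<Rightarrow> _. ellis_semigroup X \<subseteq> range D"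
proof -
  obtain d :: "nat set \<Rightarrow> (nat \<Rightarrow> bool) set" where d: "\<forall>P. fsigma_in euclidean P \<longrightarrow> P \<in> range d"
    using fsigma_sets_coded_by_nat_sets ..
  define D where "D a = restrict (\<lambda>x l. x \<in> d {k. prod_encode (l, k) \<in> a}) X" for a
  have "p \<in> range D" if p: "p \<in> ellis_semigroup X" for p
  proof -
    have "\<exists>a. {x \<in> X. p x l} = d a" for l
      using d ellis_coordinate_fsigma[OF assms p, of l] by blast
    then obtain a where a: "\<And>l. {x \<in> X. p x l} = d (a l)"
      by metis
    have "{k. prod_encode (l, k) \<in> {prod_encode (n, k) |n k. k \<in> a n}} = a l" for l
      by auto
    moreover have "p \<in> X \<rightarrow>\<^sub>E X"
      using p by (simp add: ellis_semigroup_def in_closure_of topspace_self_maps)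
    ultimately have "p = D {prod_encode (n, k) |n k. k \<in> a n}"
      using a by (auto simp: D_def fun_eq_iff restrict_def PiE_iff extensional_def set_eq_iff)
    then show ?thesis by blast
  qed
  then show ?thesis by blast
qed

section \<open>Points of the Stone-Cech compactification as ultrafilters\<close>

text \<open>
  The canonical embedding of \<open>\<nat>\<close> into \<open>\<beta>\<nat>\<close>.
\<close>

abbreviation nat_eval :: "nat \<Rightarrow> (nat \<Rightarrow> real) \<Rightarrow> real"
  where "nat_eval \<equiv> cube_eval (discrete_topology UNIV)"

text \<open>
  The point \<open>p\<close> of \<open>\<beta>\<nat>\<close>, viewed as an ultrafilter on \<open>\<nat>\<close>, contains \<open>A\<close>. The extension of the indicator of \<open>A\<close>
  takes only the values \<open>0\<close> and \<open>1\<close> on \<open>\<beta>\<nat>\<close>, so any threshold strictly between them would do.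
\<close>

definition beta_mem :: "nat set \<Rightarrow> ((nat \<Rightarrow> real) \<Rightarrow> real) \<Rightarrow> bool"
  where "beta_mem A p \<longleftrightarrow> p (\<lambda>k. of_bool (k \<in> A)) > 1/2"

lemma unit_maps_nat: "f \<in> unit_maps (discrete_topology UNIV) \<longleftrightarrow> (\<forall>k. f k \<in> {0..1})"
  by (auto simp: unit_maps_def)

lemma nat_eval_apply: "(\<And>k. f k \<in> {0..1}) \<Longrightarrow> nat_eval k f = f k"
  by (simp add: cube_eval_def unit_maps_nat)

lemma beta_mem_nat_eval: "beta_mem A (nat_eval k) \<longleftrightarrow> k \<in> A"
  by (simp add: beta_mem_def nat_eval_apply)

lemma nat_eval_in_beta: "nat_eval k \<in> topspace beta_nat"
  using closure_of_subset[of "range nat_eval" "unit_cube (discrete_topology UNIV)"]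
    cube_eval_in[of _ "discrete_topology (UNIV :: nat set)"]
  by (simp add: topspace_stone_cech image_subset_iff)

lemma continuous_map_beta_nat_apply:
  assumes "\<And>k. f k \<in> {0..1}"
  shows "continuous_map beta_nat euclideanreal (\<lambda>p. p f)"
proof -
  have f: "f \<in> unit_maps (discrete_topology UNIV)"
    using assms by (simp add: unit_maps_nat)
  have "continuous_map beta_nat (top_of_set {0..1}) (\<lambda>p. p f)"
    unfolding stone_cech_def unit_cube_def
    by (intro continuous_map_from_subtopology continuous_map_product_projection f)
  then show ?thesis
    by (rule continuous_map_into_fulltopology)
qed

lemma beta_nat_dense:
  assumes "openin beta_nat U" "p \<in> U"
  obtains k where "nat_eval k \<in> U"
proof -
  have "p \<in> topspace beta_nat"
    using openin_subset[OF assms(1)] assms(2) by blast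
  then have "p \<in> beta_nat closure_of range nat_eval"
    using dense_cube_eval[of "discrete_topology (UNIV :: nat set)"] by simp
  then show ?thesis
    using assms that unfolding in_closure_of by blast
qed

lemma openin_beta_nat_apply:
  assumes "\<And>k. f k \<in> {0..1}" "open V"
  shows "openin beta_nat {p \<in> topspace beta_nat. p f \<in> V}"
  using assms(2) by (intro openin_continuous_map_preimage[OF continuous_map_beta_nat_apply] assms(1)) simp

text \<open>
  The extended indicator avoids the value \<open>1/2\<close>, so that \<open>beta_mem A\<close> defines a clopen subset of \<open>\<beta>\<nat>\<close>.
\<close>

lemma not_beta_mem:
  assumes "p \<in> topspace beta_nat"
  shows "\<not> beta_mem A p \<longleftrightarrow> p (\<lambda>k. of_bool (k \<in> A)) < 1/2"
proof -
  let ?f = "\<lambda>k. of_bool (k \<in> A) :: real"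
  have "p ?f \<noteq> 1/2"
  proof
    assume "p ?f = 1/2"
    then have "p \<in> {p \<in> topspace beta_nat. p ?f \<in> {0<..<1}}"
      using assms by simp
    then obtain k where "nat_eval k \<in> {p \<in> topspace beta_nat. p ?f \<in> {0<..<1}}"
      by (rule beta_nat_dense[OF openin_beta_nat_apply, rotated 2]) auto
    then show False
      by (simp add: nat_eval_apply split: if_splits)
  qed
  then show ?thesis
    by (auto simp: beta_mem_def)
qed

lemma openin_beta_mem: "openin beta_nat {p \<in> topspace beta_nat. beta_mem A p = b}"
proof (cases b)
  case True
  then show ?thesis
    using openin_beta_nat_apply[of "\<lambda>k. of_bool (k \<in> A)" "{1/2<..}"]
    by (simp add: beta_mem_def)
next
  case False
  have "{p \<in> topspace beta_nat. beta_mem A p = b} =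
      {p \<in> topspace beta_nat. p (\<lambda>k. of_bool (k \<in> A)) \<in> {..<1/2}}"
    using False not_beta_mem by auto
  then show ?thesis
    using openin_beta_nat_apply[of "\<lambda>k. of_bool (k \<in> A)" "{..<1/2}"] by simp
qed

lemma closedin_beta_mem: "closedin beta_nat {p \<in> topspace beta_nat. beta_mem A p = b}"
proof -
  have "topspace beta_nat - {p \<in> topspace beta_nat. beta_mem A p = b} =
      {p \<in> topspace beta_nat. beta_mem A p = (\<not> b)}"
    by auto
  then show ?thesis
    using openin_beta_mem[of A "\<not> b"] by (simp add: closedin_def)
qed

lemma beta_mem_separates:
  assumes p: "p \<in> topspace beta_nat" and q: "q \<in> topspace beta_nat" and "p \<noteq> q"
  shows "\<exists>A. beta_mem A p \<noteq> beta_mem A q"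
proof -
  have *: "\<exists>A. beta_mem A p \<and> \<not> beta_mem A q"
    if p: "p \<in> topspace beta_nat" and q: "q \<in> topspace beta_nat"
      and f: "\<And>k. f k \<in> {0..1}" and "p f < q f" for p q f
  proof -
    obtain r where r: "p f < r" "r < q f"
      using \<open>p f < q f\<close> dense by blast
    define A where "A = {k. f k < r}"
    have "beta_mem A p"
    proof (rule ccontr)
      assume "\<not> beta_mem A p"
      define U where "U = {p \<in> topspace beta_nat. p f \<in> {..<r}} \<inter> {p \<in> topspace beta_nat. beta_mem A p = False}"
      have "openin beta_nat U"
        unfolding U_def by (intro openin_Int openin_beta_nat_apply f open_lessThan openin_beta_mem)
      moreover have "p \<in> U"
        using p r \<open>\<not> beta_mem A p\<close> by (simp add: U_def)
      ultimately obtain k where "nat_eval k \<in> U"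
        by (rule beta_nat_dense)
      then show False
        using f by (auto simp: U_def nat_eval_apply beta_mem_nat_eval A_def)
    qed
    moreover have "\<not> beta_mem A q"
    proof
      assume "beta_mem A q"
      define U where "U = {p \<in> topspace beta_nat. p f \<in> {r<..}} \<inter> {p \<in> topspace beta_nat. beta_mem A p = True}"
      have "openin beta_nat U"
        unfolding U_def by (intro openin_Int openin_beta_nat_apply f open_greaterThan openin_beta_mem)
      moreover have "q \<in> U"
        using q r \<open>beta_mem A q\<close> by (simp add: U_def)
      ultimately obtain k where "nat_eval k \<in> U"
        by (rule beta_nat_dense)
      then show False
        using f by (auto simp: U_def nat_eval_apply beta_mem_nat_eval A_def)
    qed
    ultimately show ?thesis by blast
  qed
  have ext: "p \<in> extensional (unit_maps (discrete_topology UNIV))"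
    "q \<in> extensional (unit_maps (discrete_topology UNIV))"
    using p q closure_of_subset_topspace[of "unit_cube (discrete_topology (UNIV :: nat set))"]
    unfolding topspace_stone_cech by (auto simp: unit_cube_def PiE_def)
  obtain f where "p f \<noteq> q f"
    using \<open>p \<noteq> q\<close> by blast
  then have f: "\<And>k. f k \<in> {0..1}"
    using ext by (metis extensional_arb unit_maps_nat)
  show ?thesis
  proof (cases "p f < q f")
    case True
    then show ?thesis using *[OF p q f True] by blast
  next
    case False
    then have "q f < p f"
      using \<open>p f \<noteq> q f\<close> by simp
    from *[OF q p f this] show ?thesis by blast
  qed
qed

text \<open>
  An independent family \<open>S\<close> indexed by the subsets of \<open>\<nat>\<close> provides, for each set \<open>\<Z>\<close> of subsets of \<open>\<nat>\<close>, an
  ultrafilter that contains exactly those \<open>S A\<close> with \<open>A \<in> \<Z>\<close>.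
\<close>

lemma nat_set_sets_inject_into_beta_nat:
  obtains P :: "nat set set \<Rightarrow> (nat \<Rightarrow> real) \<Rightarrow> real" where "range P \<subseteq> topspace beta_nat" "inj P"
proof -
  obtain S :: "nat set \<Rightarrow> nat set"
    where S: "\<forall>\<A> \<phi>. finite \<A> \<longrightarrow> infinite {k. \<forall>A\<in>\<A>. (k \<in> S A) = \<phi> A}"
    using independent_family_on_nat ..
  have "\<exists>p\<in>topspace beta_nat. \<forall>A\<in>UNIV. beta_mem (S A) p = (A \<in> \<Z>)" for \<Z>
  proof (rule compact_space_prescribe_values[OF compact_space_stone_cech closedin_beta_mem])
    fix J :: "nat set set" assume "finite J"
    then have "infinite {k. \<forall>A\<in>J. (k \<in> S A) = (A \<in> \<Z>)}"
      using S by (elim allE[of _ J] allE[of _ "\<lambda>A. A \<in> \<Z>"]) blast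
    from infinite_imp_nonempty[OF this] obtain k where "\<forall>A\<in>J. (k \<in> S A) = (A \<in> \<Z>)"
      by blast
    then show "\<exists>p\<in>topspace beta_nat. \<forall>A\<in>J. beta_mem (S A) p = (A \<in> \<Z>)"
      using nat_eval_in_beta by (intro bexI[of _ "nat_eval k"]) (auto simp: beta_mem_nat_eval)
  qed
  then obtain P where P: "\<And>\<Z>. P \<Z> \<in> topspace beta_nat" "\<And>\<Z> A. beta_mem (S A) (P \<Z>) = (A \<in> \<Z>)"
    by (metis UNIV_I)
  have "inj P"
  proof (rule injI)
    fix \<Y> \<Z> assume "P \<Y> = P \<Z>"
    then have "A \<in> \<Y> \<longleftrightarrow> A \<in> \<Z>" for A
      using P(2)[of A \<Y>] P(2)[of A \<Z>] by simp
    then show "\<Y> = \<Z>" by blast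
  qed
  then show ?thesis
    using that P(1) by blast
qed

section \<open>Non-tameness and free times\<close>

lemma free_times_if_non_tame:
  assumes "closed X" "non_tame X"
  shows "\<exists>M. infinite M \<and> M \<subseteq> {1..} \<and> free_times X M"
proof (rule ccontr)
  assume "\<not> ?thesis"
  then obtain D :: "nat set \<Rightarrow> (nat \<Rightarrow> bool) \<Rightarrow> nat \<Rightarrow> bool" where D: "ellis_semigroup X \<subseteq> range D"
    using ellis_semigroup_coded_by_nat_sets[OF assms(1)] by blast
  obtain h where "embedding_map beta_nat (subtopology (self_maps X) (ellis_semigroup X)) h"
    using assms(2) unfolding non_tame_def by blast
  then have h: "homeomorphic_map beta_nat
      (subtopology (subtopology (self_maps X) (ellis_semigroup X)) (h ` topspace beta_nat)) h"
    by (simp only: embedding_map_def)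
  have inj: "inj_on h (topspace beta_nat)"
    using homeomorphic_imp_injective_map[OF h] .
  have sub: "h ` topspace beta_nat \<subseteq> ellis_semigroup X"
    using equalityD1[OF homeomorphic_imp_surjective_map[OF h]] unfolding topspace_subtopology by blast
  obtain P :: "nat set set \<Rightarrow> (nat \<Rightarrow> real) \<Rightarrow> real" where P: "range P \<subseteq> topspace beta_nat" "inj P"
    by (rule nat_set_sets_inject_into_beta_nat)
  have "\<exists>a. h (P \<Z>) = D a" for \<Z>
  proof -
    have "P \<Z> \<in> topspace beta_nat"
      using P(1) by (rule subsetD) simp
    then have "h (P \<Z>) \<in> range D"
      using sub D by (meson imageI subsetD)
    then show ?thesis
      by (elim imageE) (rule exI)
  qed
  then obtain a where a: "\<And>\<Z>. h (P \<Z>) = D (a \<Z>)"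
    using choice[of "\<lambda>\<Z> a. h (P \<Z>) = D a"] by auto
  have "inj a"
  proof (rule injI)
    fix \<Y> \<Z> assume "a \<Y> = a \<Z>"
    then have "h (P \<Y>) = h (P \<Z>)"
      using a by simp
    then have "P \<Y> = P \<Z>"
      using inj P(1) by (simp add: inj_on_def image_subset_iff)
    then show "\<Y> = \<Z>"
      using P(2) by (simp add: inj_eq)
  qed
  \<comment> \<open>Thus the sets of subsets of \<open>\<nat>\<close> inject into the subsets of \<open>\<nat>\<close>.\<close>
  then have "range (inv a) = Pow UNIV"
    by (simp add: inj_imp_surj_inv)
  then show False
    using Cantors_theorem by blast
qed

text \<open>
  Along a free sequence of positive times \<open>n\<^sub>k\<close> the closure of the shifts \<open>\<sigma>\<^bsup>n\<^sub>k\<^esup>\<close> in the Ellis semigroup is a copy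
  of \<open>\<beta>\<nat>\<close>.
\<close>

lemma non_tame_if_free_times:
  assumes X: "binary_subshift X" and M: "infinite M" "M \<subseteq> {1..}" "free_times X M"
  shows "non_tame X"
proof -
  let ?n = "enumerate M"
  have shift_X: "shift x \<in> X" if "x \<in> X" for x
    using X that by (auto simp: binary_subshift_def)
  have "closed X"
    using X by (simp add: binary_subshift_def)
  have shifts_X: "(shift ^^ n) x \<in> X" if "x \<in> X" for n x
    using that by (induction n) (auto intro: shift_X)
  have n: "inj ?n" "\<And>k. ?n k \<in> M"
    using M by (auto simp: strict_mono_enumerate strict_mono_imp_inj_on enumerate_in_set)
  \<comment> \<open>\<open>g x p\<close> is the limit of \<open>\<sigma>\<^bsup>n\<^sub>k\<^esup> x\<close> along the ultrafilter \<open>p\<close>.\<close>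
  define g where "g x p l = beta_mem {k. x (?n k + l)} p" for x p l
  define h where "h p = restrict (\<lambda>x. g x p) X" for p
  have g_eval: "g x (nat_eval k) = (shift ^^ ?n k) x" for x k
    by (auto simp: g_def beta_mem_nat_eval shift_funpow add.commute fun_eq_iff)
  have cont_g: "continuous_map beta_nat euclidean (g x)" for x
  proof -
    have "continuous_map beta_nat euclidean (\<lambda>p. g x p l)" for l
      unfolding continuous_map_def
    proof (intro conjI allI impI)
      fix V :: "bool set"
      have "{p \<in> topspace beta_nat. g x p l \<in> V} =
          (\<Union>b\<in>V. {p \<in> topspace beta_nat. beta_mem {k. x (?n k + l)} p = b})"
        by (auto simp: g_def)
      then show "openin beta_nat {p \<in> topspace beta_nat. g x p l \<in> V}"
        using openin_beta_mem by (simp only:) (intro openin_Union, blast)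
    qed simp
    then show ?thesis
      by (simp add: euclidean_product_topology[symmetric] continuous_map_componentwise_UNIV)
  qed
  have g_X: "g x p \<in> X" if "x \<in> X" "p \<in> topspace beta_nat" for x p
  proof -
    have "p \<in> beta_nat closure_of range nat_eval"
      using that(2) dense_cube_eval[of "discrete_topology (UNIV :: nat set)"] by simp
    then have "g x p \<in> euclidean closure_of (g x ` range nat_eval)"
      using continuous_map_image_closure_subset[OF cont_g[of x]] by blast
    moreover have "g x ` range nat_eval \<subseteq> X"
      using shifts_X[OF that(1)] by (auto simp: g_eval)
    then have "euclidean closure_of (g x ` range nat_eval) \<subseteq> X"
      using \<open>closed X\<close> by (intro closure_of_minimal) (simp_all add: closed_closedin[symmetric])
    ultimately show ?thesis by blast
  qed
  have cont_h: "continuous_map beta_nat (self_maps X) h"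
    unfolding self_maps_def continuous_map_componentwise
  proof (intro conjI ballI)
    show "h ` topspace beta_nat \<subseteq> extensional X"
      by (auto simp: h_def)
    fix x assume "x \<in> X"
    then have "continuous_map beta_nat (top_of_set X) (g x)"
      using cont_g[of x] g_X[of x] by (auto simp: continuous_map_in_subtopology)
    then show "continuous_map beta_nat (top_of_set X) (\<lambda>p. h p x)"
      using \<open>x \<in> X\<close> by (simp add: h_def)
  qed
  have "h ` range nat_eval \<subseteq> {restrict (shift ^^ n) X |n. n \<ge> 1}"
  proof -
    have "h (nat_eval k) = restrict (shift ^^ ?n k) X" for k
      by (simp add: h_def g_eval)
    moreover have "?n k \<ge> 1" for k
      using n(2)[of k] M(2) by auto
    ultimately show ?thesis by blast
  qed
  then have "self_maps X closure_of (h ` range nat_eval) \<subseteq> ellis_semigroup X"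
    unfolding ellis_semigroup_def by (rule closure_of_mono)
  then have "h ` topspace beta_nat \<subseteq> ellis_semigroup X"
    using continuous_map_image_closure_subset[OF cont_h, of "range nat_eval"]
      dense_cube_eval[of "discrete_topology (UNIV :: nat set)"] by simp
  then have cont: "continuous_map beta_nat (subtopology (self_maps X) (ellis_semigroup X)) h"
    using cont_h by (auto simp: continuous_map_in_subtopology)
  have "Hausdorff_space (subtopology (self_maps X) (ellis_semigroup X))"
    unfolding self_maps_def using Hausdorff_space_bool_sequences
    by (intro Hausdorff_space_subtopology) (simp add: Hausdorff_space_product_topology Hausdorff_space_subtopology)
  then have "closed_map beta_nat (subtopology (self_maps X) (ellis_semigroup X)) h"
    using T1_Spaces.continuous_imp_closed_map[OF cont compact_space_stone_cech] by blast
  moreover have "inj_on h (topspace beta_nat)"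
  proof (rule inj_onI, rule ccontr)
    fix p q assume pq: "p \<in> topspace beta_nat" "q \<in> topspace beta_nat" "h p = h q" "p \<noteq> q"
    then obtain A where A: "beta_mem A p \<noteq> beta_mem A q"
      using beta_mem_separates by blast
    obtain x where x: "x \<in> X" "\<forall>t\<in>M. x t = (inv ?n t \<in> A)"
      using M(3)[unfolded free_times_def, rule_format, of "\<lambda>t. inv ?n t \<in> A"] by blast
    have "{k. x (?n k + 0)} = A"
      using x(2) n by (auto simp: inv_f_f)
    then have "g x p 0 \<noteq> g x q 0"
      using A unfolding g_def by simp
    moreover have "g x p = g x q"
      using fun_cong[OF pq(3), of x] x(1) by (simp add: h_def)
    ultimately show False by simp
  qed
  ultimately show ?thesis
    using injective_closed_imp_embedding_map[OF cont] unfolding non_tame_def by blast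
qed

theorem theorem2:
  fixes X :: "(nat \<Rightarrow> bool) set"
  assumes "binary_subshift X"
  shows "non_tame X \<longleftrightarrow> (\<exists>T. choice_domain X T \<and> uncountable T)"
proof -
  have "closed X"
    using assms by (simp add: binary_subshift_def)
  then show ?thesis
    using free_times_if_non_tame non_tame_if_free_times[OF assms]
      free_times_if_uncountable_choice_domain uncountable_choice_domain_if_free_times by metis
qed

end
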